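(* For every $n\in\mathbb{N}$, $$\prod_{k\in\mathrm{Reg}_n}\Gamma(k/n)=\frac{(2\pi)^{(\varrho(n)-1)/2}}{\sqrt{\kappa(n)}}.$$
   Context: $\mathbb{N}=\{1,2,\ldots\}$. An integer $k$ is called regular (mod $n$) if there exists $x\in\mathbb{Z}$ with $k^2x\equiv k\pmod n$, $\mathrm{Reg}_n=\{k\in\mathbb{N}:1\le k\le n,\ k\text{ is regular (mod }n)\}$, and $\varrho(n)=\#\mathrm{Reg}_n$. $\Gamma$ is the Gamma function, and $\kappa(n)=\prod_{p\mid n}p$ (product over primes) is the largest squarefree divisor of $n$. *)

theory Defs
  imports "HOL-Analysis.Analysis" "HOL-Number_Theory.Number_Theory"
begin

definition regular_mod :: "int \<Rightarrow> nat \<Rightarrow> bool" where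
  "regular_mod k n \<longleftrightarrow> (\<exists>x::int. [k\<^sup>2 * x = k] (mod int n))"

definition Reg :: "nat \<Rightarrow> nat set" where
  "Reg n = {k. 1 \<le> k \<and> k \<le> n \<and> regular_mod (int k) n}"

definition rho :: "nat \<Rightarrow> nat" where
  "rho n = card (Reg n)"

definition kappa :: "nat \<Rightarrow> nat" where
  "kappa n = (\<Prod>p | prime p \<and> p dvd n. p)"

end

theory Submission
  imports Defs
begin

text \<open>
  The reflection \<open>k \<mapsto> n - k\<close> preserves the regular residues below \<open>n\<close>, so Euler's reflection
  formula turns the square of the Gamma product into \<open>\<Prod> 2\<pi> / (2 sin (\<pi>k/n))\<close>, and the claim
  becomes \<open>\<Prod> 2 sin (\<pi>k/n) = \<kappa>(n)\<close>. Now \<open>k\<close> is regular iff \<open>m = n / gcd(k,n)\<close> is a unitary divisor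
  of \<open>n\<close>, and for fixed \<open>m > 1\<close> the factors multiply to \<open>\<Phi>\<^sub>m(1) = exp (\<Lambda>(m))\<close>, which follows by
  Moebius inversion from \<open>\<Prod>\<^bsub>0<k<n\<^esub> 2 sin (\<pi>k/n) = n\<close>. The unitary prime-power divisors of \<open>n\<close>
  are the full prime powers of \<open>n\<close>, so each prime \<open>p\<close> dividing \<open>n\<close> contributes exactly one factor \<open>p\<close>.
\<close>

section \<open>The sine product over all fractions, from roots of unity\<close>

lemma prod_one_minus_roots_unity:
  fixes n :: nat
  assumes "n > 0"
  shows "(\<Prod>z\<in>{z::complex. z ^ n = 1} - {1}. 1 - z) = of_nat n"
proof -
  define R where "R = {z::complex. z ^ n = 1} - {1}"
  have fin: "finite {z::complex. z ^ n = 1}"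
    using finite_roots_unity[of n, where 'a = complex] assms by simp
  have "finite R" and card: "card R = n - 1"
    using fin card_complex_roots_unity[of n] assms by (auto simp: R_def)
  \<comment> \<open>\<open>P\<close> is (X^n - 1)/(X - 1) factored over the nontrivial roots,
    \<open>Q\<close> the same quotient as a geometric sum. Agreement at these n - 1 points and in
    the coefficient of X^(n-1) forces \<open>P = Q\<close>; evaluation at 1 gives n.\<close>
  define P where "P = (\<Prod>z\<in>R. [:- z, 1:])"
  define Q where "Q = (\<Sum>k<n. Polynomial.monom (1::complex) k)"
  have deg_P: "degree P = n - 1"
    unfolding P_def using card by (subst degree_prod_eq_sum_degree) auto
  have "lead_coeff P = 1"
    unfolding P_def lead_coeff_prod by simp
  then have "poly.coeff P (n - 1) = poly.coeff Q (n - 1)"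
    using deg_P assms by (simp add: Q_def coeff_sum)
  moreover have "degree Q \<le> n - 1"
    unfolding Q_def by (intro degree_sum_le) (auto simp: degree_monom_eq)
  moreover have "poly P z = poly Q z" if "z \<in> R" for z
  proof -
    have "poly P z = 0"
      using that \<open>finite R\<close> by (auto simp: P_def poly_prod)
    moreover have "poly Q z = 0"
      using that by (simp add: Q_def poly_sum poly_monom R_def sum_gp_strict)
    ultimately show ?thesis by simp
  qed
  ultimately have "P = Q"
    using deg_P card by (intro poly_eqI_degree_lead_coeff[of P "n - 1" Q R]) auto
  then have "poly P 1 = poly Q 1" by simp
  then show ?thesis
    by (simp add: P_def Q_def poly_prod poly_sum poly_monom R_def)
qed

lemma sin_pi_fraction_pos:
  fixes k n :: nat
  assumes "0 < k" "k < n"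
  shows "0 < sin (pi * real k / real n)"
  using assms by (intro sin_gt_zero) (auto simp: field_simps)

text \<open>The chord from 1 to the root of unity \<open>cis (2 * pi * k / n)\<close> has length 2
  sin (pi k/n), so this is the norm of the preceding product.\<close>

lemma prod_sin_pi_fractions:
  fixes n :: nat
  assumes "n > 0"
  shows "(\<Prod>k\<in>{0<..<n}. 2 * sin (pi * real k / real n)) = real n"
proof -
  define w where "w = (\<lambda>k. cis (2 * pi * real k / real n))"
  have "bij_betw w {..<n} {z. z ^ n = 1}"
    unfolding w_def by (rule Complex.bij_betw_roots_unity[OF assms])
  moreover have "w 0 = 1" by (simp add: w_def)
  ultimately have "bij_betw w ({..<n} - {0}) ({z. z ^ n = 1} - {1})"
    using assms by (auto simp: bij_betw_def inj_on_diff inj_on_image_set_diff[of w "{..<n}"])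
  moreover have "{..<n} - {0} = {0<..<n}" by auto
  ultimately have bij: "bij_betw w {0<..<n} ({z. z ^ n = 1} - {1})" by simp
  have "2 * sin (pi * real k / real n) = norm (1 - w k)" if "k \<in> {0<..<n}" for k
  proof -
    have "norm (w k - 1) = 2 * \<bar>sin (pi * real k / real n)\<bar>"
      using dist_exp_i_1[of "2 * pi * real k / real n"] by (simp add: w_def cis_conv_exp)
    then show ?thesis
      using sin_pi_fraction_pos[of k n] that by (simp add: norm_minus_commute)
  qed
  then have "(\<Prod>k\<in>{0<..<n}. 2 * sin (pi * real k / real n)) = (\<Prod>k\<in>{0<..<n}. norm (1 - w k))"
    by (intro prod.cong) auto
  also have "\<dots> = norm (\<Prod>z\<in>{z::complex. z ^ n = 1} - {1}. 1 - z)"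
    by (subst prod.reindex_bij_betw[OF bij, symmetric]) (simp add: prod_norm)
  also have "\<dots> = real n"
    by (simp add: prod_one_minus_roots_unity assms)
  finally show ?thesis .
qed

section \<open>Primitive fractions and the von Mangoldt function\<close>

text \<open>For m > 1 this is the logarithm of the m-th cyclotomic polynomial at 1. Removing
  \<open>m\<close> matters only for m = 1, whose sole totative would bring in sin pi = 0.\<close>

definition ln_sin_primitive :: "nat \<Rightarrow> real" where
  "ln_sin_primitive m = (\<Sum>j\<in>totatives m - {m}. ln (2 * sin (pi * real j / real m)))"

text \<open>Group the fractions k/n by their reduced denominator m. As the filter \<open>P\<close>
  sees only m, it covers both the full range and the regular residues.\<close>

lemma sum_ln_sin_by_gcd:
  fixes n :: nat
  assumes "n > 0"
  shows "(\<Sum>k | k \<in> {0<..<n} \<and> P (n div gcd k n). ln (2 * sin (pi * real k / real n))) =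
    (\<Sum>m | m dvd n \<and> P m. ln_sin_primitive m)"
proof -
  define f where "f = (\<lambda>k. ln (2 * sin (pi * real k / real n)))"
  define A where "A = {k \<in> {0<..<n}. P (n div gcd k n)}"
  define D where "D = {m. m dvd n \<and> P m}"
  have "finite A" "finite D"
    using assms by (auto simp: A_def D_def)
  have "(\<lambda>k. n div gcd k n) ` A \<subseteq> D"
    by (auto simp: A_def D_def intro: div_dvd_iff_mult[THEN iffD2])
  then have "sum f A = (\<Sum>m\<in>D. sum f {k \<in> A. n div gcd k n = m})"
    by (rule sum.group[OF \<open>finite A\<close> \<open>finite D\<close>, symmetric])
  also have "\<dots> = sum ln_sin_primitive D"
  proof (rule sum.cong)
    fix m assume "m \<in> D"
    then have m: "m dvd n" "P m" by (auto simp: D_def)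
    define d where "d = n div m"
    have d: "d dvd n" "n div d = m" "n = m * d" "d > 0" "m > 0"
      using m assms by (auto simp: d_def elim!: dvdE)
    have "bij_betw (\<lambda>j. j * d) (totatives m) {k \<in> {0<..n}. gcd k n = d}"
      using bij_betw_totatives_gcd_eq[OF d(1) assms] d(2) by simp
    then have bij: "bij_betw (\<lambda>j. j * d) (totatives m - {m}) ({k \<in> {0<..n}. gcd k n = d} - {n})"
      using d by (auto simp: bij_betw_def inj_on_def image_set_diff)
    have gcd_iff: "n div gcd k n = m \<longleftrightarrow> gcd k n = d" for k
    proof
      assume "n div gcd k n = m"
      then have "m * d = m * gcd k n"
        using d(3) by (metis dvd_div_mult_self gcd_dvd2)
      then show "gcd k n = d" using d(5) by simp
    qed (use d in auto)
    have "{k \<in> A. n div gcd k n = m} = {k \<in> {0<..n}. gcd k n = d} - {n}"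
      using m by (auto simp: A_def simp flip: gcd_iff)
    then have "sum f {k \<in> A. n div gcd k n = m} = (\<Sum>j\<in>totatives m - {m}. f (j * d))"
      by (simp add: sum.reindex_bij_betw[OF bij])
    also have "\<dots> = ln_sin_primitive m"
      unfolding ln_sin_primitive_def f_def using d
      by (intro sum.cong arg_cong[where f = ln]) (auto simp: field_simps)
    finally show "sum f {k \<in> A. n div gcd k n = m} = ln_sin_primitive m" .
  qed simp
  finally show ?thesis
    by (simp add: f_def A_def D_def)
qed

lemma sum_ln_sin_primitive_divisors:
  fixes n :: nat
  assumes "n > 0"
  shows "(\<Sum>m | m dvd n. ln_sin_primitive m) = ln (real n)"
proof -
  have "(\<Sum>m | m dvd n. ln_sin_primitive m) =
    (\<Sum>k\<in>{0<..<n}. ln (2 * sin (pi * real k / real n)))"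
    using sum_ln_sin_by_gcd[OF assms, of "\<lambda>_. True"]
    by (simp only: simp_thms Collect_mem_eq)
  also have "\<dots> = ln (\<Prod>k\<in>{0<..<n}. 2 * sin (pi * real k / real n))"
    by (intro ln_prod[symmetric] finite_greaterThanLessThan)
      (metis sin_pi_fraction_pos greaterThanLessThan_iff mult_eq_0_iff less_irrefl zero_neq_numeral)
  also have "\<dots> = ln (real n)"
    by (simp only: prod_sin_pi_fractions[OF assms])
  finally show ?thesis .
qed

text \<open>The uniqueness part of Moebius inversion: the term at n is the divisor sum minus terms
  settled by strong induction.\<close>

lemma divisor_sums_eqD:
  fixes f g :: "nat \<Rightarrow> 'a :: ab_group_add"
  assumes "\<And>n. n > 0 \<Longrightarrow> (\<Sum>d | d dvd n. f d) = (\<Sum>d | d dvd n. g d)"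
  assumes "n > 0"
  shows "f n = g n"
  using assms(2)
proof (induction n rule: less_induct)
  case (less n)
  have split: "(\<Sum>d | d dvd n. h d) = h n + (\<Sum>d | d dvd n \<and> d \<noteq> n. h d)"
    for h :: "nat \<Rightarrow> 'a"
  proof -
    have "{d. d dvd n \<and> d \<noteq> n} = {d. d dvd n} - {n}" by auto
    then show ?thesis
      using less.prems by (simp add: sum.remove[of "{d. d dvd n}" n h])
  qed
  have "(\<Sum>d | d dvd n \<and> d \<noteq> n. f d) = (\<Sum>d | d dvd n \<and> d \<noteq> n. g d)"
    using less.prems by (intro sum.cong refl less.IH) (auto dest: dvd_imp_le intro: Nat.gr0I)
  then show ?case
    using assms(1)[OF less.prems] by (simp add: split)
qed

lemma ln_sin_primitive_eq_mangoldt: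
  assumes "n > 0"
  shows "ln_sin_primitive n = mangoldt n"
proof (rule divisor_sums_eqD[OF _ assms])
  fix m :: nat assume "m > 0"
  then show "(\<Sum>d | d dvd m. ln_sin_primitive d) = (\<Sum>d | d dvd m. mangoldt d)"
    by (simp add: sum_ln_sin_primitive_divisors mangoldt_sum)
qed

section \<open>Unitary divisors and the squarefree kernel\<close>

lemma unitary_primepow_divisors:
  fixes n :: nat
  assumes "n > 0"
  shows "{m. m dvd n \<and> coprime m (n div m) \<and> primepow m} =
    (\<lambda>p. p ^ multiplicity p n) ` {p. prime p \<and> p dvd n}"
proof (intro subset_antisym subsetI)
  fix m assume "m \<in> {m. m dvd n \<and> coprime m (n div m) \<and> primepow m}"
  then obtain p k where m: "m dvd n" "coprime m (n div m)" "prime p" "k > 0" "m = p ^ k"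
    by (auto simp: primepow_def)
  have n: "n = p ^ k * (n div m)" using m by simp
  have "p dvd m" using m by simp
  then have "p dvd n" "\<not> p dvd n div m"
    using m not_coprimeI[of p m "n div m"] not_prime_unit[of p] by (auto intro: dvd_trans)
  moreover from this have "multiplicity p n = k"
    using n m(3) by (intro multiplicity_decomposeI[of n p k "n div m"]) auto
  ultimately show "m \<in> (\<lambda>p. p ^ multiplicity p n) ` {p. prime p \<and> p dvd n}"
    using m by auto
next
  fix m assume "m \<in> (\<lambda>p. p ^ multiplicity p n) ` {p. prime p \<and> p dvd n}"
  then obtain p where p: "prime p" "p dvd n" "m = p ^ multiplicity p n" by auto
  have pos: "multiplicity p n > 0"
    using p assms by (simp add: prime_multiplicity_gt_zero_iff)
  have "\<not> p dvd n div p ^ multiplicity p n"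
    using p assms not_prime_unit[of p] by (intro multiplicity_decompose) auto
  then have "coprime m (n div m)"
    using p by (simp add: prime_imp_coprime)
  then show "m \<in> {m. m dvd n \<and> coprime m (n div m) \<and> primepow m}"
    using p pos by (auto simp: multiplicity_dvd primepow_def)
qed

lemma sum_mangoldt_unitary_divisors:
  fixes n :: nat
  assumes "n > 0"
  shows "(\<Sum>m | m dvd n \<and> coprime m (n div m). mangoldt m) = ln (real (kappa n))"
proof -
  define S where "S = {p. prime p \<and> p dvd n}"
  have "finite S" using assms by (auto simp: S_def)
  \<comment> \<open>This left inverse makes the map from primes to full prime powers injective on
    \<open>S\<close>, as the reindexing below requires.\<close>
  have apd: "aprimedivisor (p ^ multiplicity p n) = p" if "p \<in> S" for p
    using that assms
    by (auto simp: S_def prime_multiplicity_gt_zero_iff intro!: aprimedivisor_prime_power)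
  have "(\<Sum>m | m dvd n \<and> coprime m (n div m). mangoldt m :: real) =
      (\<Sum>m | m dvd n \<and> coprime m (n div m) \<and> primepow m. mangoldt m)"
    using assms by (intro sum.mono_neutral_right) (auto simp: mangoldt_def)
  also have "\<dots> = (\<Sum>m\<in>(\<lambda>p. p ^ multiplicity p n) ` S. mangoldt m)"
    by (simp add: unitary_primepow_divisors[OF assms] S_def)
  also have "\<dots> = (\<Sum>p\<in>S. mangoldt (p ^ multiplicity p n))"
    using apd by (subst sum.reindex) (auto intro: inj_on_inverseI)
  also have "\<dots> = (\<Sum>p\<in>S. ln (real p))"
    using assms by (intro sum.cong refl) (auto simp: S_def prime_multiplicity_gt_zero_iff)
  also have "\<dots> = ln (\<Prod>p\<in>S. real p)"
    using \<open>finite S\<close> by (intro ln_prod[symmetric]) (auto simp: S_def prime_gt_0_nat)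
  also have "\<dots> = ln (real (kappa n))"
    by (simp add: kappa_def S_def)
  finally show ?thesis .
qed

section \<open>Regular residues and their sine product\<close>

text \<open>Write k = j d and n = m d with j, m coprime. Cancelling d and then j reduces the
  congruence to k x = 1 mod m, which is solvable iff d is coprime to m, because j already
  is.\<close>

lemma regular_mod_iff_unitary:
  fixes k n :: nat
  assumes "n > 0"
  shows "regular_mod (int k) n \<longleftrightarrow> coprime (n div gcd k n) (n div (n div gcd k n))"
proof -
  define d where "d = gcd k n"
  obtain j m where jm: "k = j * d" "n = m * d" "coprime j m"
    using gcd_coprime_exists[of k n] assms unfolding d_def by auto
  have "d > 0" "m > 0" using assms jm by auto
  have "[(int k)\<^sup>2 * x = int k] (mod int n) \<longleftrightarrow> [int (j * d) * x = 1] (mod int m)" for x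
  proof -
    have "[(int k)\<^sup>2 * x = int k] (mod int n) \<longleftrightarrow>
        int d * int m dvd int d * (int j * (int (j * d) * x - 1))"
      by (simp add: cong_iff_dvd_diff jm power2_eq_square algebra_simps)
    also have "\<dots> \<longleftrightarrow> int m dvd int j * (int (j * d) * x - 1)"
      using \<open>d > 0\<close> by (subst dvd_mult_cancel_left) simp
    also have "\<dots> \<longleftrightarrow> int m dvd int (j * d) * x - 1"
      using jm(3) by (intro coprime_dvd_mult_right_iff) (simp add: coprime_commute)
    finally show ?thesis by (simp add: cong_iff_dvd_diff)
  qed
  then have "regular_mod (int k) n \<longleftrightarrow> coprime (int (j * d)) (int m)"
    by (simp add: regular_mod_def coprime_iff_invertible_int)
  also have "\<dots> \<longleftrightarrow> coprime m d"
    using jm(3) by (simp add: coprime_commute)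
  finally show ?thesis
    unfolding d_def[symmetric] using jm(2) \<open>d > 0\<close> \<open>m > 0\<close> by simp
qed

lemma regular_mod_reflect:
  assumes "regular_mod k n"
  shows "regular_mod (int n - k) n"
proof -
  from assms obtain x where x: "int n dvd k\<^sup>2 * x - k"
    by (auto simp: regular_mod_def cong_iff_dvd_diff)
  \<comment> \<open>The witness for n - k is -x, since modulo n the claim is the original congruence
    negated.\<close>
  have "(int n - k)\<^sup>2 * (- x) - (int n - k) = int n * (2 * k * x - int n * x - 1) - (k\<^sup>2 * x - k)"
    by (simp add: power2_eq_square algebra_simps)
  also have "int n dvd \<dots>"
    by (rule dvd_diff[OF dvd_triv_left x])
  finally show ?thesis
    unfolding regular_mod_def cong_iff_dvd_diff by blast
qed

text \<open>The index n is set apart: its sine vanishes, its reflection is 0, and its Gamma factor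
  is 1.\<close>

lemma Reg_Diff_self:
  "Reg n - {n} = {k \<in> {0<..<n}. regular_mod (int k) n}"
  by (auto simp: Reg_def)

lemma Reg_self:
  assumes "n \<ge> 1"
  shows "n \<in> Reg n"
  using assms by (auto simp: Reg_def regular_mod_def cong_iff_dvd_diff)

lemma prod_sin_Reg:
  fixes n :: nat
  assumes "n > 0"
  shows "(\<Prod>k\<in>Reg n - {n}. 2 * sin (pi * real k / real n)) = real (kappa n)"
proof -
  define g where "g = (\<lambda>k. 2 * sin (pi * real k / real n))"
  have pos: "g k > 0" if "k \<in> Reg n - {n}" for k
    using that sin_pi_fraction_pos[of k n] by (auto simp: Reg_Diff_self g_def)
  have "ln (prod g (Reg n - {n})) = (\<Sum>k\<in>Reg n - {n}. ln (g k))"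
    using pos by (intro ln_prod) (force simp: Reg_def)+
  also have "\<dots> = (\<Sum>m | m dvd n \<and> coprime m (n div m). ln_sin_primitive m)"
    unfolding Reg_Diff_self regular_mod_iff_unitary[OF assms] g_def
    by (rule sum_ln_sin_by_gcd[OF assms])
  also have "\<dots> = (\<Sum>m | m dvd n \<and> coprime m (n div m). mangoldt m)"
    using assms by (intro sum.cong refl ln_sin_primitive_eq_mangoldt) (auto intro: Nat.gr0I)
  also have "\<dots> = ln (real (kappa n))"
    by (rule sum_mangoldt_unitary_divisors[OF assms])
  finally have "ln (prod g (Reg n - {n})) = ln (real (kappa n))" .
  moreover have "prod g (Reg n - {n}) > 0"
    using pos by (intro prod_pos) auto
  moreover have "real (kappa n) > 0"
    unfolding kappa_def by (auto intro!: prod_pos simp: prime_gt_0_nat)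
  ultimately show ?thesis
    by (simp add: g_def)
qed

section \<open>The Gamma product by reflection\<close>

lemma Gamma_reflection_real:
  fixes x :: real
  shows "Gamma x * Gamma (1 - x) = pi / sin (pi * x)"
proof -
  have "complex_of_real (Gamma x * Gamma (1 - x)) = of_real (pi / sin (pi * x))"
    using Gamma_reflection_complex[of "of_real x"]
    by (simp flip: Gamma_complex_of_real sin_of_real)
  then show ?thesis by (simp only: of_real_eq_iff)
qed

text \<open>Squaring lets every k be paired with n - k, so a fixed point k = n/2 needs no separate
  case.\<close>

lemma prod_Gamma_Reg_square:
  fixes n :: nat
  assumes "n > 0"
  shows "(\<Prod>k\<in>Reg n - {n}. Gamma (real k / real n))\<^sup>2 =
    (2 * pi) ^ card (Reg n - {n}) / real (kappa n)"
proof -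
  define A where "A = Reg n - {n}"
  define G where "G = (\<lambda>k. Gamma (real k / real n))"
  have "n - k \<in> A" if "k \<in> A" for k
    using that regular_mod_reflect[of "int k" n] by (auto simp: A_def Reg_Diff_self of_nat_diff)
  moreover have "n - (n - k) = k" if "k \<in> A" for k
    using that by (auto simp: A_def Reg_Diff_self)
  ultimately have "prod G A = (\<Prod>k\<in>A. G (n - k))"
    by (intro prod.reindex_bij_witness[of A "\<lambda>k. n - k" "\<lambda>k. n - k"]) auto
  then have "(prod G A)\<^sup>2 = (\<Prod>k\<in>A. G k * G (n - k))"
    by (simp add: power2_eq_square prod.distrib)
  \<comment> \<open>The extra factor 2 above and below matches the denominators to
    \<open>prod_sin_Reg\<close>.\<close>
  also have "\<dots> = (\<Prod>k\<in>A. 2 * pi / (2 * sin (pi * real k / real n)))"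
  proof (rule prod.cong)
    fix k assume "k \<in> A"
    then have "real (n - k) / real n = 1 - real k / real n"
      by (auto simp: A_def Reg_Diff_self of_nat_diff field_simps)
    then show "G k * G (n - k) = 2 * pi / (2 * sin (pi * real k / real n))"
      using Gamma_reflection_real[of "real k / real n"] by (simp add: G_def)
  qed simp
  also have "\<dots> = (2 * pi) ^ card A / real (kappa n)"
    by (simp only: prod_dividef prod_constant A_def prod_sin_Reg[OF assms])
  finally show ?thesis
    by (simp add: A_def G_def)
qed

theorem proposition5p6p1:
  fixes n :: nat
  assumes "n \<ge> 1"
  shows "(\<Prod>k\<in>Reg n. Gamma (real k / real n)) =
    (2 * pi) powr ((real (rho n) - 1) / 2) / sqrt (real (kappa n))"
proof -
  have "n > 0" using assms by simp
  have "finite (Reg n)" by (simp add: Reg_def)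
  define A where "A = Reg n - {n}"
  define P where "P = (\<Prod>k\<in>A. Gamma (real k / real n))"
  have "card (Reg n) = Suc (card A)"
    unfolding A_def by (rule card.remove[OF \<open>finite (Reg n)\<close> Reg_self[OF assms]])
  then have card: "real (card A) = real (rho n) - 1"
    by (simp add: rho_def)
  \<comment> \<open>Positivity selects the right square root of the squared product.\<close>
  have "P > 0"
    unfolding P_def by (intro prod_pos) (auto simp: A_def Reg_Diff_self)
  have "(\<Prod>k\<in>Reg n. Gamma (real k / real n)) = P"
    using \<open>n > 0\<close> unfolding P_def A_def
    by (subst prod.remove[OF \<open>finite (Reg n)\<close> Reg_self[OF assms]]) simp
  also have "P = sqrt ((2 * pi) ^ card A / real (kappa n))"
    using prod_Gamma_Reg_square[OF \<open>n > 0\<close>] \<open>P > 0\<close>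
    by (intro real_sqrt_unique[symmetric]) (auto simp: P_def A_def)
  also have "\<dots> = (2 * pi) powr (real (card A) / 2) / sqrt (real (kappa n))"
    by (simp add: real_sqrt_divide powr_half_sqrt[symmetric] powr_realpow[symmetric] powr_powr
        powr_mult power_mult_distrib)
  finally show ?thesis by (simp add: card)
qed

end
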